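(* Let $N\ge2$ and let $(\mu,(f_i)_{i\in\mathbb{Z}_N})$ and $(\mu',(f_i')_{i\in\mathbb{Z}_N})$ be two monic systems. The representations of $\mathcal{O}_N$ associated to them are (unitarily) equivalent if and only if the measures $\mu$ and $\mu'$ are equivalent, i.e. $\mu\ll\mu'$ and $\mu'\ll\mu$, and there exists a (complex-valued measurable) function $h$ on $\mathcal{K}_N$ such that $$\frac{d\mu'}{d\mu}=|h|^2\qquad\text{and}\qquad f_i'=\frac{h\circ\sigma}{h}f_i\quad(i\in\mathbb{Z}_N).$$
   Context: Equalities of functions are understood $\mu$-almost everywhere. Let $\mathbb{Z}_N=\{0,1,\dots,N-1\}$. A representation of $\mathcal{O}_N$ on a Hilbert space is a family of isometries $(S_i)_{i\in\mathbb{Z}_N}$ with $S_i^*S_j=\delta_{ij}I$ and $\sum_{i}S_iS_i^*=I$. Two representations $(S_i)$ on $\mathcal{H}$ and $(S_i')$ on $\mathcal{H}'$ are equivalent if there is a unitary $W:\mathcal{H}'\to\mathcal{H}$ with $S_iW=WS_i'$ for all $i$. Let $\mathcal{K}_N=\prod_1^\infty\mathbb{Z}_N$ be the compact space of infinite words (product topology), $\sigma(\omega_1\omega_2\dots)=\omega_2\omega_3\dots$, and $\sigma_i(\omega_1\omega_2\dots)=i\omega_1\omega_2\dots$ for $i\in\mathbb{Z}_N$. $\mu\circ\sigma_i^{-1}$ denotes the push-forward $A\mapsto\mu(\sigma_i^{-1}(A))$. A monic system is a pair $(\mu,(f_i)_{i\in\mathbb{Z}_N})$ where $\mu$ is a finite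 Borel measure on $\mathcal{K}_N$ with $\mu\circ\sigma_i^{-1}\ll\mu$ for all $i$, and $f_i\in L^2(\mu)$ (complex-valued) are functions such that $\frac{d(\mu\circ\sigma_i^{-1})}{d\mu}=|f_i|^2$ and $f_i(x)\ne0$ for $\mu$-a.e. $x\in\sigma_i(\mathcal{K}_N)$. The representation of $\mathcal{O}_N$ associated to the monic system is the one on $L^2(\mu)$ given by $S_if=f_i\,(f\circ\sigma)$. *)

theory Defs
  imports "HOL-Analysis.Analysis"
begin

section \<open>Infinite words\<close>

definition words :: "nat \<Rightarrow> (nat \<Rightarrow> nat) set" where
  "words N = {w. \<forall>k. w k < N}"

text \<open>The topology of \<^typ>\<open>nat \<Rightarrow> nat\<close> is the product of the discrete topologies, so its
  trace on \<^term>\<open>words N\<close> is the product topology over the alphabet \<^term>\<open>{..<N}\<close>.\<close>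

definition borel_words :: "nat \<Rightarrow> (nat \<Rightarrow> nat) measure" where
  "borel_words N = restrict_space borel (words N)"

definition word_shift :: "(nat \<Rightarrow> nat) \<Rightarrow> nat \<Rightarrow> nat" where
  "word_shift w = (\<lambda>k. w (Suc k))"

definition word_cons :: "nat \<Rightarrow> (nat \<Rightarrow> nat) \<Rightarrow> nat \<Rightarrow> nat" where
  "word_cons i w = case_nat i w"


section \<open>Complex inner product spaces and unitary equivalence\<close>

record 'v inner_space =
  vectors :: "'v set"
  vadd :: "'v \<Rightarrow> 'v \<Rightarrow> 'v"
  vscale :: "complex \<Rightarrow> 'v \<Rightarrow> 'v"
  vinner :: "'v \<Rightarrow> 'v \<Rightarrow> complex"

definition unitary_between :: "'v inner_space \<Rightarrow> 'w inner_space \<Rightarrow> ('v \<Rightarrow> 'w) \<Rightarrow> bool" where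
  "unitary_between H K W \<longleftrightarrow>
     bij_betw W (vectors H) (vectors K) \<and>
     (\<forall>x\<in>vectors H. \<forall>y\<in>vectors H. W (vadd H x y) = vadd K (W x) (W y)) \<and>
     (\<forall>c. \<forall>x\<in>vectors H. W (vscale H c x) = vscale K c (W x)) \<and>
     (\<forall>x\<in>vectors H. \<forall>y\<in>vectors H. vinner K (W x) (W y) = vinner H x y)"

definition equivalent_reps ::
  "nat \<Rightarrow> 'v inner_space \<Rightarrow> (nat \<Rightarrow> 'v \<Rightarrow> 'v) \<Rightarrow> 'w inner_space \<Rightarrow> (nat \<Rightarrow> 'w \<Rightarrow> 'w) \<Rightarrow> bool" where
  "equivalent_reps N H S H' S' \<longleftrightarrow>
     (\<exists>W. unitary_between H' H W \<and> (\<forall>i<N. \<forall>x\<in>vectors H'. S i (W x) = W (S' i x)))"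


section \<open>The Hilbert space of square-integrable functions\<close>

definition square_integrable :: "'a measure \<Rightarrow> ('a \<Rightarrow> complex) set" where
  "square_integrable M = {f \<in> borel_measurable M. integrable M (\<lambda>x. (cmod (f x))\<^sup>2)}"

definition ae_eq_rel :: "'a measure \<Rightarrow> (('a \<Rightarrow> complex) \<times> ('a \<Rightarrow> complex)) set" where
  "ae_eq_rel M =
     {(f, g). f \<in> square_integrable M \<and> g \<in> square_integrable M \<and> (AE x in M. f x = g x)}"

text \<open>The vectors are the classes modulo almost everywhere equality. An operation on classes is
  the union of its values over all representatives, all of which coincide.\<close>

definition L2 :: "'a measure \<Rightarrow> ('a \<Rightarrow> complex) set inner_space" where
  "L2 M = \<lparr>
     vectors = square_integrable M // ae_eq_rel M,
     vadd = (\<lambda>F G. \<Union>f\<in>F. \<Union>g\<in>G. ae_eq_rel M `` {\<lambda>x. f x + g x}),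
     vscale = (\<lambda>c F. \<Union>f\<in>F. ae_eq_rel M `` {\<lambda>x. c * f x}),
     vinner = (\<lambda>F G. the_elem (\<Union>f\<in>F. \<Union>g\<in>G. {\<integral>x. f x * cnj (g x) \<partial>M}))\<rparr>"


section \<open>Monic systems\<close>

text \<open>In the library, \<^term>\<open>absolutely_continuous M M'\<close> means that \<open>M'\<close> is absolutely continuous
  with respect to \<open>M\<close>, and \<^term>\<open>RN_deriv M M'\<close> is the derivative of \<open>M'\<close> with respect to \<open>M\<close>.\<close>

definition monic_system ::
  "nat \<Rightarrow> (nat \<Rightarrow> nat) measure \<Rightarrow> (nat \<Rightarrow> (nat \<Rightarrow> nat) \<Rightarrow> complex) \<Rightarrow> bool" where
  "monic_system N \<mu> f \<longleftrightarrow>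
     finite_measure \<mu> \<and> sets \<mu> = sets (borel_words N) \<and>
     (\<forall>i<N. absolutely_continuous \<mu> (distr \<mu> \<mu> (word_cons i)) \<and>
            f i \<in> square_integrable \<mu> \<and>
            (AE x in \<mu>. RN_deriv \<mu> (distr \<mu> \<mu> (word_cons i)) x = ennreal ((cmod (f i x))\<^sup>2)) \<and>
            (AE x in \<mu>. x \<in> word_cons i ` words N \<longrightarrow> f i x \<noteq> 0))"

text \<open>For a monic system and \<open>i < N\<close>, the function below is again square integrable and, up to
  null sets, independent of the representative \<open>g\<close>, because \<open>\<mu> \<circ> \<sigma>\<^sub>i\<^sup>-\<^sup>1\<close> has density
  \<open>\<bar>f\<^sub>i\<bar>\<^sup>2\<close> with respect to \<open>\<mu>\<close> and \<open>\<sigma> \<circ> \<sigma>\<^sub>i = id\<close>.\<close>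

definition monic_rep ::
  "(nat \<Rightarrow> nat) measure \<Rightarrow> (nat \<Rightarrow> (nat \<Rightarrow> nat) \<Rightarrow> complex) \<Rightarrow>
   nat \<Rightarrow> ((nat \<Rightarrow> nat) \<Rightarrow> complex) set \<Rightarrow> ((nat \<Rightarrow> nat) \<Rightarrow> complex) set" where
  "monic_rep \<mu> f i G = (\<Union>g\<in>G. ae_eq_rel \<mu> `` {\<lambda>x. f i x * g (word_shift x)})"

end

theory Submission
  imports Defs
begin

text \<open>If \<open>d\<mu>' = \<bar>h\<bar>\<^sup>2 d\<mu>\<close>, then multiplication by \<open>h\<close> is a unitary \<open>L\<^sup>2(\<mu>') \<rightarrow> L\<^sup>2(\<mu>)\<close>, and it
  intertwines exactly when \<open>h f\<^sub>i' = (h \<circ> \<sigma>) f\<^sub>i\<close>. Conversely, let \<open>W\<close> be an intertwining unitary. The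
  range of \<open>S\<^sub>i\<close> consists of the functions supported on \<open>\<sigma>\<^sub>i(K)\<close>, so the Borel sets \<open>A\<close> for which
  \<open>W\<close> and its inverse map functions supported on \<open>A\<close> to functions supported on \<open>A\<close> are closed under
  \<open>A \<mapsto> \<sigma>\<^sub>i(A)\<close>; by orthogonality they form a \<open>\<sigma>\<close>-algebra, hence are all the Borel sets. With
  \<open>h = W 1\<close> this gives \<open>W \<chi>\<^sub>A = \<chi>\<^sub>A h\<close>, and comparing inner products yields \<open>d\<mu>' = \<bar>h\<bar>\<^sup>2 d\<mu>\<close> and
  \<open>W g = h g\<close> for all \<open>g\<close>; apply the latter to \<open>g = f\<^sub>i' = S\<^sub>i' 1\<close>.\<close>

section \<open>Infinite words\<close>

lemma space_borel_words [simp]: "space (borel_words N) = words N"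
  by (simp add: borel_words_def space_restrict_space)

lemma word_shift_cons [simp]: "word_shift (word_cons i x) = x"
  by (simp add: word_shift_def word_cons_def)

lemma word_cons_shift: "x 0 = i \<Longrightarrow> word_cons i (word_shift x) = x"
  by (auto simp: word_shift_def word_cons_def fun_eq_iff split: nat.split)

lemma word_shift_in_words: "x \<in> words N \<Longrightarrow> word_shift x \<in> words N"
  by (simp add: words_def word_shift_def)

lemma in_words_iff_word_shift: "x \<in> words N \<longleftrightarrow> x 0 < N \<and> word_shift x \<in> words N"
  unfolding words_def word_shift_def by (auto intro: nat.exhaust) (metis not0_implies_Suc)

lemma word_cons_in_words: "i < N \<Longrightarrow> x \<in> words N \<Longrightarrow> word_cons i x \<in> words N"
  by (auto simp: words_def word_cons_def split: nat.split)

lemma in_image_word_cons_iff: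
  assumes "i < N" "A \<subseteq> words N"
  shows "x \<in> word_cons i ` A \<longleftrightarrow> x 0 = i \<and> word_shift x \<in> A"
proof
  assume "x \<in> word_cons i ` A"
  then show "x 0 = i \<and> word_shift x \<in> A"
    by (auto simp: word_cons_def word_shift_def)
next
  assume "x 0 = i \<and> word_shift x \<in> A"
  then show "x \<in> word_cons i ` A"
    by (metis imageI word_cons_shift)
qed

lemma measurable_coordinate: "(\<lambda>x. x k) \<in> borel_measurable (borel_words N)"
  unfolding borel_words_def by (intro measurable_restrict_space1) simp

lemma measurable_borel_words:
  assumes "\<And>x. x \<in> space M \<Longrightarrow> T x \<in> words N"
    and "\<And>k. (\<lambda>x. T x k) \<in> borel_measurable M"
  shows "T \<in> M \<rightarrow>\<^sub>M borel_words N"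
  unfolding borel_words_def
  using assms by (intro measurable_restrict_space2 measurable_coordinatewise_then_product) auto

lemma measurable_word_shift: "word_shift \<in> borel_words N \<rightarrow>\<^sub>M borel_words N"
  by (rule measurable_borel_words)
    (simp_all add: word_shift_in_words measurable_coordinate, simp add: word_shift_def measurable_coordinate)

lemma measurable_word_cons:
  assumes "i < N"
  shows "word_cons i \<in> borel_words N \<rightarrow>\<^sub>M borel_words N"
proof (rule measurable_borel_words)
  fix k
  show "(\<lambda>x. word_cons i x k) \<in> borel_measurable (borel_words N)"
    by (cases k) (simp_all add: word_cons_def measurable_coordinate)
qed (simp add: word_cons_in_words assms)

text \<open>Serves as the induction principle behind \<open>localized_borel\<close>: it reduces
  Borel sets to the sets fixing one letter, complements and countable unions.\<close>

lemma sets_borel_words: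
  "sets (borel_words N) = sigma_sets (words N) {{x \<in> words N. x k = j} |k j. True}"
  (is "_ = sigma_sets _ ?G")
proof
  have coord: "{x \<in> words N. x k = j} \<in> sets (borel_words N)" for k j
  proof -
    have "(\<lambda>x. x k) -` {j} \<inter> space (borel_words N) \<in> sets (borel_words N)"
      by (rule measurable_sets[OF measurable_coordinate]) simp
    then show ?thesis
      by (simp add: vimage_def Collect_conj_eq Int_commute)
  qed
  show "sigma_sets (words N) ?G \<subseteq> sets (borel_words N)"
    using sets.sigma_sets_subset[of ?G "borel_words N"] coord by auto
  \<comment> \<open>For the other inclusion: \<open>nat\<close> is countable and discrete, so each
    coordinate is measurable for the generated sigma-algebra, and hence so is the identity into the
    product.\<close>
  let ?S = "sigma (words N) ?G"
  have G: "?G \<subseteq> Pow (words N)" by auto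
  have "(\<lambda>x. x k) \<in> ?S \<rightarrow>\<^sub>M count_space UNIV" for k
  proof (rule measurable_count_space_eq2_countable[THEN iffD2])
    show "(\<lambda>x. x k) \<in> space ?S \<rightarrow> UNIV \<and> (\<forall>a\<in>UNIV. (\<lambda>x. x k) -` {a} \<inter> space ?S \<in> sets ?S)"
      using G by (auto simp: vimage_def Int_def conj_commute intro!: sigma_sets.Basic)
  qed
  then have "(\<lambda>x. x k) \<in> borel_measurable ?S" for k
    by (subst measurable_cong_sets[OF refl, of borel "count_space UNIV"]) (simp_all add: sets_borel_eq_count_space)
  then have "(\<lambda>x. x) \<in> borel_measurable ?S"
    by (intro measurable_coordinatewise_then_product)
  then show "sets (borel_words N) \<subseteq> sigma_sets (words N) ?G"
    using G by (auto simp: borel_words_def sets_restrict_space measurable_def vimage_def Int_commute)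
qed


section \<open>Square-integrable functions\<close>

lemma borel_measurable_cnj [measurable (raw)]:
  assumes "g \<in> borel_measurable M"
  shows "(\<lambda>x. cnj (g x)) \<in> borel_measurable M"
  by (rule measurable_compose[OF assms borel_measurable_continuous_onI])
    (intro continuous_intros)

lemma square_integrable_measurable: "f \<in> square_integrable M \<Longrightarrow> f \<in> borel_measurable M"
  by (simp add: square_integrable_def)

lemma square_integrable_integrable:
  "f \<in> square_integrable M \<Longrightarrow> integrable M (\<lambda>x. (cmod (f x))\<^sup>2)"
  by (simp add: square_integrable_def)

lemma square_integrable_bound:
  assumes "f \<in> square_integrable M" "g \<in> borel_measurable M"
    and "\<And>x. x \<in> space M \<Longrightarrow> cmod (g x) \<le> cmod (f x)"
  shows "g \<in> square_integrable M"
proof -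
  have "integrable M (\<lambda>x. (cmod (g x))\<^sup>2)"
    using assms by (intro Bochner_Integration.integrable_bound[OF square_integrable_integrable[OF assms(1)]])
      (auto intro!: AE_I2 power_mono)
  with assms(2) show ?thesis by (simp add: square_integrable_def)
qed

lemma square_integrable_const:
  assumes "finite_measure M"
  shows "(\<lambda>x. c) \<in> square_integrable M"
  using finite_measure.integrable_const[OF assms] by (simp add: square_integrable_def)

lemma square_integrable_cmult:
  assumes "f \<in> square_integrable M"
  shows "(\<lambda>x. c * f x) \<in> square_integrable M"
proof -
  note [measurable] = square_integrable_measurable[OF assms]
  show ?thesis
    using square_integrable_integrable[OF assms]
    by (simp add: square_integrable_def norm_mult power_mult_distrib)
qed

lemma square_integrable_add:
  assumes "f \<in> square_integrable M" "g \<in> square_integrable M"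
  shows "(\<lambda>x. f x + g x) \<in> square_integrable M"
proof -
  note [measurable] = assms[THEN square_integrable_measurable]
  have "(cmod (f x + g x))\<^sup>2 \<le> 2 * (cmod (f x))\<^sup>2 + 2 * (cmod (g x))\<^sup>2" for x
  proof -
    have "(cmod (f x + g x))\<^sup>2 \<le> (cmod (f x) + cmod (g x))\<^sup>2"
      by (intro power_mono norm_triangle_ineq) simp
    also have "\<dots> \<le> 2 * (cmod (f x))\<^sup>2 + 2 * (cmod (g x))\<^sup>2"
      using zero_le_power2[of "cmod (f x) - cmod (g x)"] by (simp add: power2_eq_square algebra_simps)
    finally show ?thesis .
  qed
  moreover have "integrable M (\<lambda>x. 2 * (cmod (f x))\<^sup>2 + 2 * (cmod (g x))\<^sup>2)"
    using assms[THEN square_integrable_integrable] by simp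
  ultimately have "integrable M (\<lambda>x. (cmod (f x + g x))\<^sup>2)"
    by (rule_tac Bochner_Integration.integrable_bound) (auto intro!: AE_I2)
  then show ?thesis by (simp add: square_integrable_def)
qed

lemma square_integrable_diff:
  assumes "f \<in> square_integrable M" "g \<in> square_integrable M"
  shows "(\<lambda>x. f x - g x) \<in> square_integrable M"
  using square_integrable_add[OF assms(1) square_integrable_cmult[OF assms(2), of "-1"]] by simp

lemma square_integrable_indicator:
  assumes "f \<in> square_integrable M" "A \<in> sets M"
  shows "(\<lambda>x. indicator A x * f x) \<in> square_integrable M"
proof -
  note [measurable] = assms(2) square_integrable_measurable[OF assms(1)]
  show ?thesis
    by (rule square_integrable_bound[OF assms(1)]) (auto simp: indicator_def)
qed

lemma integrable_inner:
  assumes "f \<in> square_integrable M" "g \<in> square_integrable M"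
  shows "integrable M (\<lambda>x. f x * cnj (g x))"
proof -
  note [measurable] = assms[THEN square_integrable_measurable]
  have "cmod (f x * cnj (g x)) \<le> (cmod (f x))\<^sup>2 + (cmod (g x))\<^sup>2" for x
  proof -
    have "cmod (f x * cnj (g x)) = cmod (f x) * cmod (g x)" by (simp add: norm_mult)
    also have "\<dots> \<le> 2 * cmod (f x) * cmod (g x)" by simp
    also have "\<dots> \<le> (cmod (f x))\<^sup>2 + (cmod (g x))\<^sup>2" by (rule sum_squares_bound)
    finally show ?thesis .
  qed
  moreover have "integrable M (\<lambda>x. (cmod (f x))\<^sup>2 + (cmod (g x))\<^sup>2)"
    using assms[THEN square_integrable_integrable] by simp
  ultimately show ?thesis
    by (rule_tac Bochner_Integration.integrable_bound) (auto intro!: AE_I2)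
qed

lemma integral_inner_self_eq_0:
  assumes "f \<in> square_integrable M" "(\<integral>x. f x * cnj (f x) \<partial>M) = 0"
  shows "AE x in M. f x = 0"
proof -
  have "(\<integral>x. f x * cnj (f x) \<partial>M) = complex_of_real (\<integral>x. (cmod (f x))\<^sup>2 \<partial>M)"
    by (simp only: complex_norm_square[symmetric] integral_complex_of_real)
  with assms(2) have "(\<integral>x. (cmod (f x))\<^sup>2 \<partial>M) = 0" by simp
  then have "AE x in M. (cmod (f x))\<^sup>2 = 0"
    using integral_nonneg_eq_0_iff_AE[OF square_integrable_integrable[OF assms(1)]] by simp
  then show ?thesis by simp
qed

text \<open>The zero set of \<open>h\<close> is null for \<open>M'\<close> by the density formula,
  hence null for \<open>M\<close>, since the last assumption makes \<open>M\<close> absolutely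
  continuous with respect to \<open>M'\<close>.\<close>

lemma sqrt_density_nonzero:
  assumes h [measurable]: "h \<in> borel_measurable M"
    and dens: "density M (\<lambda>x. ennreal ((cmod (h x))\<^sup>2)) = M'"
    and ac: "absolutely_continuous M' M"
  shows "AE x in M. h x \<noteq> 0"
proof -
  have "{x \<in> space M. h x = 0} \<in> null_sets M'"
    unfolding dens[symmetric] by (subst null_sets_density_iff) auto
  then have "{x \<in> space M. h x = 0} \<in> null_sets M"
    using ac by (auto simp: absolutely_continuous_def)
  then show ?thesis by (auto simp: eventually_ae_filter)
qed

section \<open>Calculus of classes modulo almost everywhere equality\<close>

definition L2_class :: "'a measure \<Rightarrow> ('a \<Rightarrow> complex) \<Rightarrow> ('a \<Rightarrow> complex) set" where
  "L2_class M f = ae_eq_rel M `` {f}"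

lemma in_L2_class_iff:
  "g \<in> L2_class M f \<longleftrightarrow>
    f \<in> square_integrable M \<and> g \<in> square_integrable M \<and> (AE x in M. f x = g x)"
  by (auto simp: L2_class_def ae_eq_rel_def)

lemma L2_class_eq_iff:
  assumes "f \<in> square_integrable M" "g \<in> square_integrable M"
  shows "L2_class M f = L2_class M g \<longleftrightarrow> (AE x in M. f x = g x)"
proof
  assume "L2_class M f = L2_class M g"
  then have "g \<in> L2_class M f" using assms by (simp add: in_L2_class_iff)
  then show "AE x in M. f x = g x" by (simp add: in_L2_class_iff)
next
  assume ae: "AE x in M. f x = g x"
  have "(AE x in M. f x = k x) \<longleftrightarrow> (AE x in M. g x = k x)" for k
    by (rule eventually_subst, use ae in eventually_elim) simp
  then show "L2_class M f = L2_class M g"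
    using assms by (auto simp: in_L2_class_iff)
qed

lemma vectors_L2: "vectors (L2 M) = L2_class M ` square_integrable M"
  by (auto simp: L2_def quotient_def L2_class_def)

text \<open>The operations on classes are unions over all representatives; such a union collapses to
  a single value once that value does not depend on the representative.\<close>

lemma UN_L2_class:
  assumes "f \<in> square_integrable M"
    and "\<And>k. k \<in> square_integrable M \<Longrightarrow> (AE x in M. f x = k x) \<Longrightarrow> \<Phi> k = c"
  shows "(\<Union>k\<in>L2_class M f. \<Phi> k) = c"
proof -
  have "\<Phi> k = c" if "k \<in> L2_class M f" for k
    using assms(2) that by (simp add: in_L2_class_iff)
  moreover have "f \<in> L2_class M f" using assms(1) by (simp add: in_L2_class_iff)
  ultimately show ?thesis by auto
qed

lemma vadd_L2:
  assumes "f \<in> square_integrable M" "g \<in> square_integrable M"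
  shows "vadd (L2 M) (L2_class M f) (L2_class M g) = L2_class M (\<lambda>x. f x + g x)"
proof -
  have "(\<Union>f'\<in>L2_class M f. \<Union>g'\<in>L2_class M g. L2_class M (\<lambda>x. f' x + g' x)) =
      L2_class M (\<lambda>x. f x + g x)"
  proof (intro UN_L2_class assms)
    fix f' g' assume *: "f' \<in> square_integrable M" "g' \<in> square_integrable M"
      and ae: "AE x in M. f x = f' x" "AE x in M. g x = g' x"
    have "AE x in M. f' x + g' x = f x + g x" using ae by eventually_elim simp
    then show "L2_class M (\<lambda>x. f' x + g' x) = L2_class M (\<lambda>x. f x + g x)"
      using * assms by (simp add: L2_class_eq_iff square_integrable_add)
  qed
  then show ?thesis by (simp add: L2_def L2_class_def)
qed

lemma vscale_L2:
  assumes "f \<in> square_integrable M"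
  shows "vscale (L2 M) c (L2_class M f) = L2_class M (\<lambda>x. c * f x)"
proof -
  have "(\<Union>f'\<in>L2_class M f. L2_class M (\<lambda>x. c * f' x)) = L2_class M (\<lambda>x. c * f x)"
  proof (intro UN_L2_class assms)
    fix f' assume *: "f' \<in> square_integrable M" and ae: "AE x in M. f x = f' x"
    have "AE x in M. c * f' x = c * f x" using ae by eventually_elim simp
    then show "L2_class M (\<lambda>x. c * f' x) = L2_class M (\<lambda>x. c * f x)"
      using * assms by (simp add: L2_class_eq_iff square_integrable_cmult)
  qed
  then show ?thesis by (simp add: L2_def L2_class_def)
qed

lemma vinner_L2:
  assumes "f \<in> square_integrable M" "g \<in> square_integrable M"
  shows "vinner (L2 M) (L2_class M f) (L2_class M g) = (\<integral>x. f x * cnj (g x) \<partial>M)"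
proof -
  have "(\<Union>f'\<in>L2_class M f. \<Union>g'\<in>L2_class M g. {\<integral>x. f' x * cnj (g' x) \<partial>M}) =
      {\<integral>x. f x * cnj (g x) \<partial>M}"
  proof (intro UN_L2_class assms)
    fix f' g' assume *: "f' \<in> square_integrable M" "g' \<in> square_integrable M"
      and ae: "AE x in M. f x = f' x" "AE x in M. g x = g' x"
    note [measurable] = *[THEN square_integrable_measurable] assms[THEN square_integrable_measurable]
    have "AE x in M. f' x * cnj (g' x) = f x * cnj (g x)" using ae by eventually_elim simp
    then have "(\<integral>x. f' x * cnj (g' x) \<partial>M) = (\<integral>x. f x * cnj (g x) \<partial>M)"
      by (rule integral_cong_AE[rotated 2]) measurable
    then show "{\<integral>x. f' x * cnj (g' x) \<partial>M} = {\<integral>x. f x * cnj (g x) \<partial>M}"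
      by simp
  qed
  then show ?thesis by (simp add: L2_def L2_class_def)
qed


section \<open>The representation of a monic system\<close>

locale monic =
  fixes N :: nat and \<mu> :: "(nat \<Rightarrow> nat) measure" and f :: "nat \<Rightarrow> (nat \<Rightarrow> nat) \<Rightarrow> complex"
  assumes monic: "monic_system N \<mu> f"
begin

lemma finite_measure: "finite_measure \<mu>"
  using monic by (simp add: monic_system_def)

sublocale finite_measure \<mu>
  by (rule finite_measure)

lemma sets_eq: "sets \<mu> = sets (borel_words N)"
  using monic by (simp add: monic_system_def)

lemma space_eq: "space \<mu> = words N"
  using sets_eq_imp_space_eq[OF sets_eq] by simp

lemma measurable_shift [measurable]: "word_shift \<in> \<mu> \<rightarrow>\<^sub>M \<mu>"
  using measurable_word_shift measurable_cong_sets[OF sets_eq sets_eq] by blast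

lemma measurable_cons [measurable]: "i < N \<Longrightarrow> word_cons i \<in> \<mu> \<rightarrow>\<^sub>M \<mu>"
  using measurable_word_cons measurable_cong_sets[OF sets_eq sets_eq] by blast

lemma f_square_integrable: "i < N \<Longrightarrow> f i \<in> square_integrable \<mu>"
  using monic by (simp add: monic_system_def)

lemma measurable_f [measurable]: "i < N \<Longrightarrow> f i \<in> borel_measurable \<mu>"
  by (simp add: f_square_integrable square_integrable_measurable)

lemma measurable_density:
  "i < N \<Longrightarrow> (\<lambda>x. ennreal ((cmod (f i x))\<^sup>2)) \<in> borel_measurable \<mu>"
  by measurable

lemma f_nonzero: "i < N \<Longrightarrow> AE x in \<mu>. x 0 = i \<longrightarrow> f i x \<noteq> 0"
proof -
  assume i: "i < N"
  then have "AE x in \<mu>. x \<in> word_cons i ` words N \<longrightarrow> f i x \<noteq> 0"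
    using monic by (simp add: monic_system_def)
  then show ?thesis
    using AE_space
  proof eventually_elim
    case (elim x)
    then show ?case using i
      by (simp add: in_image_word_cons_iff space_eq word_shift_in_words)
  qed
qed

text \<open>Turns the condition on derivatives into an identity of measures, the form in which null
  sets and integrals are transported along sigma_i.\<close>

lemma distr_cons:
  assumes i: "i < N"
  shows "distr \<mu> \<mu> (word_cons i) = density \<mu> (\<lambda>x. ennreal ((cmod (f i x))\<^sup>2))"
proof -
  have "density \<mu> (RN_deriv \<mu> (distr \<mu> \<mu> (word_cons i))) = distr \<mu> \<mu> (word_cons i)"
    using monic i by (intro density_RN_deriv) (auto simp: monic_system_def)
  moreover have "density \<mu> (RN_deriv \<mu> (distr \<mu> \<mu> (word_cons i))) =
      density \<mu> (\<lambda>x. ennreal ((cmod (f i x))\<^sup>2))"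
    using monic i by (intro density_cong) (auto simp: monic_system_def)
  ultimately show ?thesis by simp
qed

text \<open>Pulling a null set back by the shift and then by sigma_i returns the null set itself.
  Its shift-preimage is therefore null for the push-forward, whose density vanishes there almost
  everywhere. This makes S_i well defined on classes.\<close>

lemma AE_shift:
  assumes i: "i < N" and P: "AE x in \<mu>. P x"
  shows "AE x in \<mu>. f i x \<noteq> 0 \<longrightarrow> P (word_shift x)"
proof -
  note [measurable] = i
  obtain Z where Z: "{x \<in> space \<mu>. \<not> P x} \<subseteq> Z" "Z \<in> null_sets \<mu>"
    using P by (auto simp: eventually_ae_filter)
  note Z' [measurable] = null_setsD2[OF Z(2)]
  let ?Y = "word_shift -` Z \<inter> space \<mu>"
  have Y: "?Y \<in> sets \<mu>" by measurable
  have "emeasure (distr \<mu> \<mu> (word_cons i)) ?Y = emeasure \<mu> (word_cons i -` ?Y \<inter> space \<mu>)"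
    by (rule emeasure_distr) (use i Y in auto)
  also have "word_cons i -` ?Y \<inter> space \<mu> = Z"
    using sets.sets_into_space[OF Z'] i by (auto simp: space_eq word_cons_in_words)
  finally have "?Y \<in> null_sets (distr \<mu> \<mu> (word_cons i))"
    using Z(2) Y by (simp add: null_sets_def)
  then have "AE x in \<mu>. x \<in> ?Y \<longrightarrow> ennreal ((cmod (f i x))\<^sup>2) = 0"
    unfolding distr_cons[OF i] by (subst (asm) null_sets_density_iff) (use i in simp_all)
  then show ?thesis
    using AE_space
  proof eventually_elim
    case (elim x)
    then show ?case
      using Z(1) word_shift_in_words[of x N] by (auto simp: space_eq)
  qed
qed

text \<open>The push-forward has a density with respect to \<open>\<mu>\<close>, so it charges no
  \<open>\<mu>\<close>-null set.\<close>

lemma AE_cons: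
  assumes i: "i < N" and P: "AE x in \<mu>. P x"
  shows "AE x in \<mu>. P (word_cons i x)"
proof -
  note [measurable] = i
  have "AE x in distr \<mu> \<mu> (word_cons i). P x"
    unfolding distr_cons[OF i] AE_density[OF measurable_density[OF i]]
    using P by eventually_elim simp
  then show ?thesis by (rule AE_distrD[OF measurable_cons[OF i]])
qed

text \<open>The push-forward gives no mass to words with another first letter, so its density
  vanishes on them. Together with \<open>f_nonzero\<close> this determines the support of
  \<open>f i\<close> up to null sets.\<close>

lemma f_zero:
  assumes i: "i < N"
  shows "AE x in \<mu>. x 0 \<noteq> i \<longrightarrow> f i x = 0"
proof -
  note [measurable] = i
  let ?Y = "{x \<in> space \<mu>. x 0 \<noteq> i}"
  have "(\<lambda>x. x 0) \<in> \<mu> \<rightarrow>\<^sub>M borel"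
    using measurable_coordinate measurable_cong_sets[OF sets_eq refl] by blast
  then have Y: "?Y \<in> sets \<mu>" by measurable
  have "emeasure (distr \<mu> \<mu> (word_cons i)) ?Y = emeasure \<mu> (word_cons i -` ?Y \<inter> space \<mu>)"
    by (rule emeasure_distr) (use i Y in auto)
  also have "word_cons i -` ?Y \<inter> space \<mu> = {}"
    by (auto simp: word_cons_def)
  finally have "?Y \<in> null_sets (distr \<mu> \<mu> (word_cons i))"
    using Y by (simp add: null_sets_def)
  then have "AE x in \<mu>. x \<in> ?Y \<longrightarrow> ennreal ((cmod (f i x))\<^sup>2) = 0"
    unfolding distr_cons[OF i] by (subst (asm) null_sets_density_iff) (use i in simp_all)
  then show ?thesis
    using AE_space by eventually_elim auto
qed

section \<open>Change of variables, the operators S_i and their adjoints\<close>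

lemma integrable_cons_iff:
  fixes u :: "(nat \<Rightarrow> nat) \<Rightarrow> real"
  assumes i: "i < N" and [measurable]: "u \<in> borel_measurable \<mu>"
  shows "integrable \<mu> (\<lambda>x. u (word_cons i x)) \<longleftrightarrow> integrable \<mu> (\<lambda>x. (cmod (f i x))\<^sup>2 * u x)"
proof -
  note [measurable] = i
  have "integrable \<mu> (\<lambda>x. u (word_cons i x)) \<longleftrightarrow> integrable (distr \<mu> \<mu> (word_cons i)) u"
    by (rule integrable_distr_eq[symmetric]) (use i in auto)
  also have "\<dots> \<longleftrightarrow> integrable \<mu> (\<lambda>x. (cmod (f i x))\<^sup>2 *\<^sub>R u x)"
    unfolding distr_cons[OF i] by (rule integrable_density) (use i in auto)
  finally show ?thesis by simp
qed

text \<open>Composing with sigma_i undoes the shift, so the change of variables reduces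
  integrability to that of the squared modulus of \<open>g\<close>.\<close>

lemma rep_square_integrable:
  assumes i: "i < N" and g: "g \<in> square_integrable \<mu>"
  shows "(\<lambda>x. f i x * g (word_shift x)) \<in> square_integrable \<mu>"
proof -
  note [measurable] = i square_integrable_measurable[OF g]
  have "integrable \<mu> (\<lambda>x. (cmod (f i x))\<^sup>2 * (cmod (g (word_shift x)))\<^sup>2)"
    using square_integrable_integrable[OF g]
    by (subst integrable_cons_iff[symmetric]) (use i in auto)
  then show ?thesis
    using i by (simp add: square_integrable_def norm_mult power_mult_distrib)
qed

text \<open>This function is the adjoint of S_i applied to \<open>g\<close>; on functions supported
  on the words starting with \<open>i\<close> it inverts S_i.\<close>

lemma corep_square_integrable:
  assumes i: "i < N" and g: "g \<in> square_integrable \<mu>"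
  shows "(\<lambda>x. g (word_cons i x) / f i (word_cons i x)) \<in> square_integrable \<mu>"
proof -
  note [measurable] = i square_integrable_measurable[OF g]
  \<comment> \<open>Division by zero gives 0, so the integrand is bounded by the squared modulus of
    \<open>g\<close> also where \<open>f i\<close> vanishes.\<close>
  have "integrable \<mu> (\<lambda>x. (cmod (f i x))\<^sup>2 * (cmod (g x / f i x))\<^sup>2)"
    by (rule Bochner_Integration.integrable_bound[OF square_integrable_integrable[OF g]])
      (use i in \<open>auto simp: norm_divide power_divide intro!: AE_I2\<close>)
  then have "integrable \<mu> (\<lambda>x. (cmod (g (word_cons i x) / f i (word_cons i x)))\<^sup>2)"
    by (subst integrable_cons_iff) (use i in auto)
  then show ?thesis
    using i by (simp add: square_integrable_def)
qed

lemma monic_rep_L2_class: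
  assumes i: "i < N" and g: "g \<in> square_integrable \<mu>"
  shows "monic_rep \<mu> f i (L2_class \<mu> g) = L2_class \<mu> (\<lambda>x. f i x * g (word_shift x))"
proof -
  have "(\<Union>k\<in>L2_class \<mu> g. L2_class \<mu> (\<lambda>x. f i x * k (word_shift x))) =
      L2_class \<mu> (\<lambda>x. f i x * g (word_shift x))"
  proof (intro UN_L2_class g)
    fix k assume k: "k \<in> square_integrable \<mu>" and ae: "AE x in \<mu>. g x = k x"
    have "AE x in \<mu>. f i x * k (word_shift x) = f i x * g (word_shift x)"
      using AE_shift[OF i ae] by eventually_elim auto
    then show "L2_class \<mu> (\<lambda>x. f i x * k (word_shift x)) = L2_class \<mu> (\<lambda>x. f i x * g (word_shift x))"
      using i k g by (simp add: L2_class_eq_iff rep_square_integrable)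
  qed
  then show ?thesis by (simp add: monic_rep_def L2_class_def)
qed

end

section \<open>Intertwining relations\<close>

text \<open>Stated as an equivalence, so that the notion is unchanged when the two systems are
  exchanged; closure properties then need a proof in one direction only.\<close>

definition localized ::
  "'a measure \<Rightarrow> 'a measure \<Rightarrow> (('a \<Rightarrow> complex) \<Rightarrow> ('a \<Rightarrow> complex) \<Rightarrow> bool) \<Rightarrow> 'a set \<Rightarrow> bool" where
  "localized M M' R A \<longleftrightarrow>
    (\<forall>g k. R g k \<longrightarrow> ((AE x in M. x \<notin> A \<longrightarrow> g x = 0) \<longleftrightarrow> (AE x in M'. x \<notin> A \<longrightarrow> k x = 0)))"

lemma localizedD:
  assumes "localized M M' R A" "R g k" "AE x in M. x \<notin> A \<longrightarrow> g x = 0"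
  shows "AE x in M'. x \<notin> A \<longrightarrow> k x = 0"
  using assms by (simp add: localized_def)

lemma localized_converse: "localized M' M (\<lambda>k g. R g k) A \<longleftrightarrow> localized M M' R A"
  by (auto simp: localized_def)

text \<open>The graph of an intertwining unitary, on representatives. Unlike the operator itself, this
  notion is visibly symmetric in the two monic systems.\<close>

locale intertwining = dom: monic N \<mu> f + cod: monic N \<mu>' f'
  for N \<mu> f \<mu>' f' +
  fixes R :: "((nat \<Rightarrow> nat) \<Rightarrow> complex) \<Rightarrow> ((nat \<Rightarrow> nat) \<Rightarrow> complex) \<Rightarrow> bool"
  assumes dom_square_integrable: "R g k \<Longrightarrow> g \<in> square_integrable \<mu>"
    and cod_square_integrable: "R g k \<Longrightarrow> k \<in> square_integrable \<mu>'"
    and total: "g \<in> square_integrable \<mu> \<Longrightarrow> \<exists>k. R g k"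
    and surj: "k \<in> square_integrable \<mu>' \<Longrightarrow> \<exists>g. R g k"
    and inner: "R g k \<Longrightarrow> R g1 k1 \<Longrightarrow>
      (\<integral>x. g x * cnj (g1 x) \<partial>\<mu>) = (\<integral>x. k x * cnj (k1 x) \<partial>\<mu>')"
    and diff: "R g k \<Longrightarrow> R g1 k1 \<Longrightarrow> R (\<lambda>x. g x - g1 x) (\<lambda>x. k x - k1 x)"
    and rep: "R g k \<Longrightarrow> i < N \<Longrightarrow>
      R (\<lambda>x. f i x * g (word_shift x)) (\<lambda>x. f' i x * k (word_shift x))"
    and dom_cong: "R g k \<Longrightarrow> g1 \<in> square_integrable \<mu> \<Longrightarrow> (AE x in \<mu>. g x = g1 x) \<Longrightarrow> R g1 k"
    and cod_cong: "R g k \<Longrightarrow> k1 \<in> square_integrable \<mu>' \<Longrightarrow> (AE x in \<mu>'. k x = k1 x) \<Longrightarrow> R g k1"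
begin

text \<open>Lets every one-sided statement about \<open>R\<close> be applied with the two systems
  exchanged.\<close>

lemma converse: "intertwining N \<mu>' f' \<mu> f (\<lambda>k g. R g k)"
proof unfold_locales
  show "R (\<lambda>x. f i x * g (word_shift x)) (\<lambda>x. f' i x * k (word_shift x))"
    if "R g k" "i < N" for g k i
    using that by (rule rep)
  show "R (\<lambda>x. g x - g1 x) (\<lambda>x. k x - k1 x)" if "R g k" "R g1 k1" for g k g1 k1
    using that by (rule diff)
  show "(\<integral>x. k x * cnj (k1 x) \<partial>\<mu>') = (\<integral>x. g x * cnj (g1 x) \<partial>\<mu>)"
    if "R g k" "R g1 k1" for g k g1 k1
    using inner[OF that] by simp
qed (blast intro: dom_square_integrable cod_square_integrable total surj dom_cong cod_cong)+

text \<open>The difference of two images of \<open>g\<close> is an image of zero, and inner products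
  are preserved, so its norm is zero.\<close>

lemma functional:
  assumes "R g k" "R g k1"
  shows "AE x in \<mu>'. k x = k1 x"
proof -
  have *: "R (\<lambda>x. g x - g x) (\<lambda>x. k x - k1 x)" by (rule diff) fact+
  have "(\<integral>x. (k x - k1 x) * cnj (k x - k1 x) \<partial>\<mu>') = 0"
    using inner[OF * *] by simp
  then have "AE x in \<mu>'. k x - k1 x = 0"
    by (rule integral_inner_self_eq_0[OF cod_square_integrable[OF *]])
  then show ?thesis by simp
qed

text \<open>A function supported on \<open>\<sigma>\<^sub>i A\<close> is \<open>S\<^sub>i\<close> of a function supported on \<open>A\<close>.\<close>

lemma vanishing_image_cons:
  assumes i: "i < N" and A: "A \<subseteq> words N" "localized \<mu> \<mu>' R A"
    and R: "R g k" and g: "AE x in \<mu>. x \<notin> word_cons i ` A \<longrightarrow> g x = 0"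
  shows "AE x in \<mu>'. x \<notin> word_cons i ` A \<longrightarrow> k x = 0"
proof -
  \<comment> \<open>The adjoint of S_i at \<open>g\<close>. As \<open>g\<close> is supported on the
    sigma_i-image of \<open>A\<close>, applying S_i to \<open>g0\<close> recovers \<open>g\<close>,
    and \<open>g0\<close> is supported on \<open>A\<close>.\<close>
  define g0 where "g0 = (\<lambda>x. g (word_cons i x) / f i (word_cons i x))"
  have "g0 \<in> square_integrable \<mu>"
    unfolding g0_def by (rule dom.corep_square_integrable[OF i dom_square_integrable[OF R]])
  then obtain k0 where R0: "R g0 k0" using total by blast
  have "AE x in \<mu>. f i x * g0 (word_shift x) = g x"
    using g dom.f_zero[OF i] dom.f_nonzero[OF i]
  proof eventually_elim
    case (elim x)
    show ?case
    proof (cases "x 0 = i")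
      case True
      with elim show ?thesis by (simp add: g0_def word_cons_shift)
    next
      case False
      then have "x \<notin> word_cons i ` A" using in_image_word_cons_iff[OF i A(1)] by simp
      with False elim show ?thesis by simp
    qed
  qed
  then have "R g (\<lambda>x. f' i x * k0 (word_shift x))"
    by (rule dom_cong[OF rep[OF R0 i] dom_square_integrable[OF R]])
  then have k: "AE x in \<mu>'. k x = f' i x * k0 (word_shift x)"
    by (rule functional[OF R])
  have "AE x in \<mu>. x \<notin> A \<longrightarrow> g0 x = 0"
    using dom.AE_cons[OF i g]
    by eventually_elim (auto simp: g0_def in_image_word_cons_iff[OF i A(1)])
  then have "AE x in \<mu>'. x \<notin> A \<longrightarrow> k0 x = 0"
    by (rule localizedD[OF A(2), OF R0])
  from k cod.AE_shift[OF i this] cod.f_zero[OF i] show ?thesis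
    by eventually_elim (auto simp: in_image_word_cons_iff[OF i A(1)])
qed

lemma localized_image_cons:
  assumes "i < N" "A \<subseteq> words N" "localized \<mu> \<mu>' R A"
  shows "localized \<mu> \<mu>' R (word_cons i ` A)"
proof -
  interpret conv: intertwining N \<mu>' f' \<mu> f "\<lambda>k g. R g k" by (rule converse)
  have "localized \<mu>' \<mu> (\<lambda>k g. R g k) A"
    using assms(3) by (rule localized_converse[THEN iffD2])
  note * = vanishing_image_cons[OF assms] conv.vanishing_image_cons[OF assms(1,2) this]
  show ?thesis unfolding localized_def by (intro allI impI iffI) (fact *)+
qed

text \<open>Functions vanishing on \<open>A\<close> form the orthogonal complement of those supported on \<open>A\<close>.\<close>

lemma vanishing_complement:
  assumes A: "A \<in> sets (borel_words N)" "localized \<mu> \<mu>' R A"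
    and R: "R g k" and g: "AE x in \<mu>. x \<notin> words N - A \<longrightarrow> g x = 0"
  shows "AE x in \<mu>'. x \<notin> words N - A \<longrightarrow> k x = 0"
proof -
  \<comment> \<open>The part of \<open>k\<close> on \<open>A\<close>. Since \<open>A\<close> is
    localized, it comes from some \<open>g1\<close> supported on \<open>A\<close>, which is
    orthogonal to \<open>g\<close>. Hence the inner product of \<open>k\<close> and
    \<open>k1\<close>, which is the squared norm of \<open>k1\<close>, is zero.\<close>
  define k1 where "k1 = (\<lambda>x. indicator A x * k x)"
  have k1: "k1 \<in> square_integrable \<mu>'"
    unfolding k1_def
    by (rule square_integrable_indicator[OF cod_square_integrable[OF R]]) (simp add: A cod.sets_eq)
  then obtain g1 where R1: "R g1 k1" using surj by blast
  have "AE x in \<mu>. x \<notin> A \<longrightarrow> g1 x = 0"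
    using A(2) R1 by (auto simp: localized_def k1_def)
  with g have "AE x in \<mu>. g x * cnj (g1 x) = 0"
    by eventually_elim auto
  then have "(\<integral>x. g x * cnj (g1 x) \<partial>\<mu>) = 0"
    by (rule integral_eq_zero_AE)
  then have "(\<integral>x. k x * cnj (k1 x) \<partial>\<mu>') = 0"
    using inner[OF R R1] by simp
  moreover have "k x * cnj (k1 x) = k1 x * cnj (k1 x)" for x
    by (simp add: k1_def indicator_def)
  ultimately have "AE x in \<mu>'. k1 x = 0"
    using integral_inner_self_eq_0[OF k1] by simp
  then show ?thesis
    using AE_space by eventually_elim (auto simp: k1_def cod.space_eq indicator_def split: if_splits)
qed

lemma localized_complement:
  assumes "A \<in> sets (borel_words N)" "localized \<mu> \<mu>' R A"
  shows "localized \<mu> \<mu>' R (words N - A)"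
proof -
  interpret conv: intertwining N \<mu>' f' \<mu> f "\<lambda>k g. R g k" by (rule converse)
  have "localized \<mu>' \<mu> (\<lambda>k g. R g k) A"
    using assms(2) by (rule localized_converse[THEN iffD2])
  note * = vanishing_complement[OF assms] conv.vanishing_complement[OF assms(1) this]
  show ?thesis unfolding localized_def by (intro allI impI iffI) (fact *)+
qed

section \<open>The sigma-algebra of localized sets\<close>

lemma localized_INT:
  fixes B :: "nat \<Rightarrow> (nat \<Rightarrow> nat) set"
  assumes "\<And>n. localized \<mu> \<mu>' R (B n)"
  shows "localized \<mu> \<mu>' R (\<Inter>n. B n)"
proof -
  \<comment> \<open>Countably many almost everywhere statements hold simultaneously, so support in
    the intersection is support in every \<open>B n\<close>.\<close>
  have *: "(AE x in M. x \<notin> (\<Inter>n. B n) \<longrightarrow> u x = 0) \<longleftrightarrow> (\<forall>n. AE x in M. x \<notin> B n \<longrightarrow> u x = 0)"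
    for M and u :: "(nat \<Rightarrow> nat) \<Rightarrow> complex"
    unfolding AE_all_countable[symmetric] by (intro AE_cong) auto
  show ?thesis
    using assms unfolding localized_def * by blast
qed

lemma localized_UN:
  fixes B :: "nat \<Rightarrow> (nat \<Rightarrow> nat) set"
  assumes "\<And>n. B n \<in> sets (borel_words N)" "\<And>n. localized \<mu> \<mu>' R (B n)"
  shows "localized \<mu> \<mu>' R (\<Union>n. B n)"
proof -
  have "(\<Inter>n. words N - B n) \<in> sets (borel_words N)"
    using assms(1) sets.compl_sets[of _ "borel_words N"] by (intro sets.countable_INT) auto
  then have "localized \<mu> \<mu>' R (words N - (\<Inter>n. words N - B n))"
    using assms by (intro localized_complement localized_INT)
  moreover have "words N - (\<Inter>n. words N - B n) = (\<Union>n. B n)"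
    using sets.sets_into_space[OF assms(1)] by auto
  ultimately show ?thesis by simp
qed

text \<open>The whole space is localized because its support condition is void for both measures;
  the empty set is its complement.\<close>

lemma localized_empty: "localized \<mu> \<mu>' R {}"
proof -
  have "AE x in \<mu>. x \<in> words N" "AE x in \<mu>'. x \<in> words N"
    using AE_space[of \<mu>] AE_space[of \<mu>'] by (simp_all add: dom.space_eq cod.space_eq)
  then have "AE x in \<mu>. x \<notin> words N \<longrightarrow> g x = 0" "AE x in \<mu>'. x \<notin> words N \<longrightarrow> g x = 0"
    for g :: "(nat \<Rightarrow> nat) \<Rightarrow> complex"
    by auto
  then have "localized \<mu> \<mu>' R (words N)"
    by (simp add: localized_def)
  from localized_complement[OF _ this] show ?thesis
    using sets.top[of "borel_words N"] by simp
qed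

text \<open>Induction on the position: the words with \<open>j\<close> at position
  \<open>Suc k\<close> are the union, over the first letter \<open>i\<close>, of the sigma_i-images
  of the words with \<open>j\<close> at position \<open>k\<close>.\<close>

lemma localized_coordinate: "localized \<mu> \<mu>' R {x \<in> words N. x k = j}"
proof (induction k)
  case 0
  have words: "localized \<mu> \<mu>' R (words N)"
    using localized_complement[OF _ localized_empty] by simp
  show ?case
  proof (cases "j < N")
    case True
    have "x \<in> words N \<and> x 0 = j \<longleftrightarrow> x \<in> word_cons j ` words N" for x
      by (subst in_image_word_cons_iff[OF True order_refl], subst in_words_iff_word_shift)
        (use True in blast)
    then have "{x \<in> words N. x 0 = j} = word_cons j ` words N" by blast
    then show ?thesis
      using localized_image_cons[OF True order_refl words] by simp
  next
    case False
    then have "{x \<in> words N. x 0 = j} = {}" by (auto simp: words_def)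
    then show ?thesis using localized_empty by (simp only:)
  qed
next
  case (Suc k)
  let ?A = "{x \<in> words N. x k = j}"
  \<comment> \<open>Padding with the empty set from \<open>N\<close> on gives a sequence indexed by
    all of \<open>nat\<close>, as \<open>localized_UN\<close> expects.\<close>
  let ?B = "\<lambda>i. if i < N then word_cons i ` ?A else {}"
  have image: "word_cons i ` ?A = {x \<in> words N. x 0 = i} \<inter> {x \<in> words N. x (Suc k) = j}"
    if "i < N" for i
  proof (rule set_eqI)
    fix x
    have "x \<in> word_cons i ` ?A \<longleftrightarrow> x 0 = i \<and> word_shift x \<in> words N \<and> x (Suc k) = j"
      by (subst in_image_word_cons_iff[OF that]) (auto simp: word_shift_def)
    also have "\<dots> \<longleftrightarrow> x \<in> words N \<and> x 0 = i \<and> x (Suc k) = j"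
      using that in_words_iff_word_shift[of x N] by blast
    finally show "x \<in> word_cons i ` ?A \<longleftrightarrow>
        x \<in> {x \<in> words N. x 0 = i} \<inter> {x \<in> words N. x (Suc k) = j}"
      by blast
  qed
  have coord: "{x \<in> words N. x k = j} \<in> sets (borel_words N)" for k j
    unfolding sets_borel_words by (rule sigma_sets.Basic) blast
  have "?B i \<in> sets (borel_words N)" for i
    using image[of i] by (simp add: sets.Int coord)
  moreover have "localized \<mu> \<mu>' R (?B i)" for i
    using localized_image_cons[of i ?A] Suc localized_empty by auto
  ultimately have "localized \<mu> \<mu>' R (\<Union>i. ?B i)" by (rule localized_UN)
  moreover have "(\<Union>i. ?B i) = (\<Union>i\<in>{..<N}. {x \<in> words N. x 0 = i} \<inter> {x \<in> words N. x (Suc k) = j})"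
    using image by force
  moreover have "\<dots> = {x \<in> words N. x (Suc k) = j}"
    by (auto simp: words_def)
  ultimately show ?case by simp
qed

lemma localized_borel:
  assumes "A \<in> sets (borel_words N)"
  shows "localized \<mu> \<mu>' R A"
  using assms unfolding sets_borel_words
proof induction
  case (Basic a)
  then show ?case using localized_coordinate by auto
next
  case Empty
  show ?case by (rule localized_empty)
next
  case (Compl a)
  then show ?case by (intro localized_complement) (simp_all add: sets_borel_words)
next
  case (Union a)
  then show ?case by (intro localized_UN) (simp_all add: sets_borel_words)
qed

section \<open>The image \<open>h\<close> of the constant function 1\<close>

lemma indicator_image:
  assumes h: "R (\<lambda>x. 1) h" and A: "A \<in> sets \<mu>"
  shows "R (indicator A) (\<lambda>x. indicator A x * h x)"
proof -
  have "(\<lambda>x. indicator A x * 1) \<in> square_integrable \<mu>"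
    by (rule square_integrable_indicator[OF square_integrable_const[OF dom.finite_measure] A])
  then obtain a where a: "R (indicator A) a"
    using total by auto
  have A': "A \<in> sets (borel_words N)" using A by (simp add: dom.sets_eq)
  \<comment> \<open>The constant 1 splits into the indicators of \<open>A\<close> and of its
    complement. The image \<open>a\<close> of the first lives on \<open>A\<close> and the image
    \<open>h - a\<close> of the second off \<open>A\<close>, so \<open>a\<close> is \<open>h\<close>
    cut down to \<open>A\<close>.\<close>
  have "AE x in \<mu>'. x \<notin> A \<longrightarrow> a x = 0"
    by (rule localizedD[OF localized_borel[OF A'], OF a]) simp
  moreover
  have "AE x in \<mu>. x \<notin> words N - A \<longrightarrow> 1 - indicator A x = (0::complex)"
    using AE_space by eventually_elim (auto simp: dom.space_eq)
  then have "AE x in \<mu>'. x \<notin> words N - A \<longrightarrow> h x - a x = 0"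
    by (rule localizedD[OF localized_complement[OF A' localized_borel[OF A']], OF diff[OF h a]])
  ultimately have "AE x in \<mu>'. a x = indicator A x * h x"
    by eventually_elim (auto simp: indicator_def)
  moreover have "(\<lambda>x. indicator A x * h x) \<in> square_integrable \<mu>'"
    by (rule square_integrable_indicator[OF cod_square_integrable[OF h]]) (simp add: A' cod.sets_eq)
  ultimately show ?thesis by (intro cod_cong[OF a])
qed

text \<open>The squared norm of the indicator of \<open>A\<close> is the
  \<open>\<mu>\<close>-measure of \<open>A\<close>; that of its image is the integral of the squared
  modulus of \<open>h\<close> over \<open>A\<close>. Preservation of inner products equates
  them.\<close>

lemma density_image_one:
  assumes h: "R (\<lambda>x. 1) h"
  shows "density \<mu>' (\<lambda>x. ennreal ((cmod (h x))\<^sup>2)) = \<mu>"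
proof (rule measure_eqI)
  note [measurable] = square_integrable_measurable[OF cod_square_integrable[OF h]]
  show "sets (density \<mu>' (\<lambda>x. ennreal ((cmod (h x))\<^sup>2))) = sets \<mu>"
    by (simp add: dom.sets_eq cod.sets_eq)
  fix A assume "A \<in> sets (density \<mu>' (\<lambda>x. ennreal ((cmod (h x))\<^sup>2)))"
  then have [measurable]: "A \<in> sets \<mu>'" and A: "A \<in> sets \<mu>"
    by (simp_all add: dom.sets_eq cod.sets_eq)
  have int: "integrable \<mu>' (\<lambda>x. (cmod (indicator A x * h x))\<^sup>2)"
    by (rule square_integrable_integrable[OF cod_square_integrable[OF indicator_image[OF h A]]])
  have "complex_of_real (measure \<mu> A) = (\<integral>x. indicator A x * cnj (indicator A x) \<partial>\<mu>)"
  proof -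
    have "(\<integral>x. indicator A x * cnj (indicator A x) \<partial>\<mu>) = (\<integral>x. complex_of_real (indicator A x) \<partial>\<mu>)"
      by (intro Bochner_Integration.integral_cong) (auto simp: indicator_def)
    also have "\<dots> = complex_of_real (\<integral>x. indicator A x \<partial>\<mu>)" by (rule integral_complex_of_real)
    finally show ?thesis using A sets.sets_into_space[OF A] by (simp add: Int_absorb2)
  qed
  also have "\<dots> = (\<integral>x. indicator A x * h x * cnj (indicator A x * h x) \<partial>\<mu>')"
    by (rule inner[OF indicator_image[OF h A] indicator_image[OF h A]])
  also have "\<dots> = complex_of_real (\<integral>x. (cmod (indicator A x * h x))\<^sup>2 \<partial>\<mu>')"
    by (simp only: complex_norm_square[symmetric] integral_complex_of_real)
  finally have "measure \<mu> A = (\<integral>x. (cmod (indicator A x * h x))\<^sup>2 \<partial>\<mu>')"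
    by (simp only: of_real_eq_iff)
  then have "emeasure \<mu> A = (\<integral>\<^sup>+x. ennreal ((cmod (indicator A x * h x))\<^sup>2) \<partial>\<mu>')"
    using nn_integral_eq_integral[OF int] by (simp add: dom.emeasure_eq_measure)
  also have "\<dots> = (\<integral>\<^sup>+x. ennreal ((cmod (h x))\<^sup>2) * indicator A x \<partial>\<mu>')"
    by (intro nn_integral_cong) (auto simp: indicator_def)
  also have "\<dots> = emeasure (density \<mu>' (\<lambda>x. ennreal ((cmod (h x))\<^sup>2))) A"
    by (rule emeasure_density[symmetric]) measurable
  finally show "emeasure (density \<mu>' (\<lambda>x. ennreal ((cmod (h x))\<^sup>2))) A = emeasure \<mu> A" ..
qed

lemma ex_image_one: "\<exists>h. R (\<lambda>x. 1) h"
  by (rule total[OF square_integrable_const[OF dom.finite_measure]])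

lemma absolutely_continuous: "absolutely_continuous \<mu>' \<mu>"
proof -
  obtain h where h: "R (\<lambda>x. 1) h" using ex_image_one by blast
  note [measurable] = square_integrable_measurable[OF cod_square_integrable[OF h]]
  show ?thesis
    by (subst density_image_one[OF h, symmetric], rule absolutely_continuousI_density) measurable
qed

text \<open>The zero set of \<open>h\<close> is \<open>\<mu>\<close>-null by
  \<open>density_image_one\<close>. The converse relation makes \<open>\<mu>'\<close> absolutely
  continuous with respect to \<open>\<mu>\<close>, so this set is \<open>\<mu>'\<close>-null
  too.\<close>

lemma image_one_nonzero:
  assumes h: "R (\<lambda>x. 1) h"
  shows "AE x in \<mu>'. h x \<noteq> 0"
proof -
  interpret conv: intertwining N \<mu>' f' \<mu> f "\<lambda>k g. R g k" by (rule converse)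
  show ?thesis
    by (rule sqrt_density_nonzero[OF square_integrable_measurable[OF cod_square_integrable[OF h]]
      density_image_one[OF h] conv.absolutely_continuous])
qed

text \<open>Compare the inner products of \<open>k\<close> and \<open>g\<close> with corresponding indicator functions.\<close>

lemma image_eq_mult:
  assumes h: "R (\<lambda>x. 1) h" and R: "R g k"
  shows "AE x in \<mu>'. k x = h x * g x"
proof -
  note [measurable] = square_integrable_measurable[OF cod_square_integrable[OF h]]
    square_integrable_measurable[OF cod_square_integrable[OF R]]
  have "borel_measurable \<mu> = borel_measurable \<mu>'"
    by (rule measurable_cong_sets) (simp_all add: dom.sets_eq cod.sets_eq)
  then have g [measurable]: "g \<in> borel_measurable \<mu>'"
    using square_integrable_measurable[OF dom_square_integrable[OF R]] by blast
  have dens: "density \<mu>' (\<lambda>x. ennreal ((cmod (h x))\<^sup>2)) = \<mu>" by (rule density_image_one[OF h])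
  \<comment> \<open>It suffices that both sides have equal integrals over every \<open>A\<close>:
    the left one pairs \<open>k\<close> with the image of the indicator, the right one is the
    pairing of \<open>g\<close> with the indicator, rewritten by the density of
    \<open>\<mu>\<close>.\<close>
  have "AE x in \<mu>'. k x * cnj (h x) = (cmod (h x))\<^sup>2 *\<^sub>R g x"
  proof (rule cod.density_unique_banach)
    show "integrable \<mu>' (\<lambda>x. k x * cnj (h x))"
      by (rule integrable_inner[OF cod_square_integrable[OF R] cod_square_integrable[OF h]])
    \<comment> \<open>The product of \<open>g\<close> with the square-integrable constant 1 is
      integrable.\<close>
    have "integrable \<mu> g"
      using integrable_inner[OF dom_square_integrable[OF R] dom_square_integrable[OF h]] by simp
    then have "integrable (density \<mu>' (\<lambda>x. ennreal ((cmod (h x))\<^sup>2))) g" by (simp add: dens)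
    then show "integrable \<mu>' (\<lambda>x. (cmod (h x))\<^sup>2 *\<^sub>R g x)"
      by (subst (asm) integrable_density) auto
    fix A assume A': "A \<in> sets \<mu>'"
    then have A: "A \<in> sets \<mu>" by (simp add: dom.sets_eq cod.sets_eq)
    note [measurable] = A'
    have "(LINT x:A|\<mu>'. k x * cnj (h x)) = (\<integral>x. k x * cnj (indicator A x * h x) \<partial>\<mu>')"
      unfolding set_lebesgue_integral_def
      by (intro Bochner_Integration.integral_cong) (auto simp: indicator_def)
    also have "\<dots> = (\<integral>x. g x * cnj (indicator A x) \<partial>\<mu>)"
      by (rule inner[OF R indicator_image[OF h A], symmetric])
    also have "\<dots> = (\<integral>x. g x * cnj (indicator A x) \<partial>density \<mu>' (\<lambda>x. ennreal ((cmod (h x))\<^sup>2)))"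
      by (simp add: dens)
    also have "\<dots> = (\<integral>x. (cmod (h x))\<^sup>2 *\<^sub>R (g x * cnj (indicator A x)) \<partial>\<mu>')"
      by (rule integral_density) auto
    also have "\<dots> = (LINT x:A|\<mu>'. (cmod (h x))\<^sup>2 *\<^sub>R g x)"
      unfolding set_lebesgue_integral_def
      by (intro Bochner_Integration.integral_cong) (auto simp: indicator_def)
    finally show "(LINT x:A|\<mu>'. k x * cnj (h x)) = (LINT x:A|\<mu>'. (cmod (h x))\<^sup>2 *\<^sub>R g x)" .
  qed
  then show ?thesis
    using image_one_nonzero[OF h]
  proof eventually_elim
    case (elim x)
    have "k x * cnj (h x) = h x * g x * cnj (h x)"
      using elim(1) by (simp only: scaleR_conv_of_real complex_norm_square mult_ac)
    with elim(2) show ?case by simp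
  qed
qed

end

section \<open>Multiplication by a function whose squared modulus is the density\<close>

lemma mult_sqrt_density_square_integrable:
  assumes h: "h \<in> borel_measurable M" and dens: "density M (\<lambda>x. ennreal ((cmod (h x))\<^sup>2)) = M'"
    and g: "g \<in> borel_measurable M"
  shows "(\<lambda>x. h x * g x) \<in> square_integrable M \<longleftrightarrow> g \<in> square_integrable M'"
proof -
  note [measurable] = h g
  have [measurable]: "g \<in> borel_measurable M'" by (simp add: dens[symmetric])
  have "integrable M' (\<lambda>x. (cmod (g x))\<^sup>2) \<longleftrightarrow> integrable M (\<lambda>x. (cmod (h x))\<^sup>2 *\<^sub>R (cmod (g x))\<^sup>2)"
    unfolding dens[symmetric] by (rule integrable_density) auto
  then show ?thesis by (simp add: square_integrable_def norm_mult power_mult_distrib)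
qed

text \<open>Inner products are preserved because the density is \<open>h\<close> times its
  conjugate. As \<open>h\<close> is nonzero almost everywhere, the two measures have the same null
  sets and division by \<open>h\<close> gives the inverse.\<close>

lemma unitary_mult_sqrt_density:
  assumes h [measurable]: "h \<in> borel_measurable M"
    and dens: "density M (\<lambda>x. ennreal ((cmod (h x))\<^sup>2)) = M'"
    and nonzero: "AE x in M. h x \<noteq> 0"
  shows "\<exists>W. unitary_between (L2 M') (L2 M) W \<and>
    (\<forall>g\<in>square_integrable M'. (\<lambda>x. h x * g x) \<in> square_integrable M \<and>
      W (L2_class M' g) = L2_class M (\<lambda>x. h x * g x))"
proof -
  define W where "W F = (\<Union>g\<in>F. L2_class M (\<lambda>x. h x * g x))" for F
  have AE: "(AE x in M'. P x) \<longleftrightarrow> (AE x in M. P x)" for P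
  proof -
    have "(AE x in M'. P x) \<longleftrightarrow> (AE x in M. 0 < ennreal ((cmod (h x))\<^sup>2) \<longrightarrow> P x)"
      unfolding dens[symmetric] by (rule AE_density) measurable
    also have "\<dots> \<longleftrightarrow> (AE x in M. P x)"
      by (rule eventually_subst, use nonzero in eventually_elim) simp
    finally show ?thesis .
  qed
  have meas: "g \<in> borel_measurable M" if "g \<in> square_integrable M'" for g
    using square_integrable_measurable[OF that] by (simp add: dens[symmetric])
  have mult: "(\<lambda>x. h x * g x) \<in> square_integrable M" if "g \<in> square_integrable M'" for g
    using mult_sqrt_density_square_integrable[OF h dens meas[OF that]] that by simp
  have cong: "(AE x in M. h x * g x = h x * k x) \<longleftrightarrow> (AE x in M'. g x = k x)" for g k
    unfolding AE by (rule eventually_subst, use nonzero in eventually_elim) simp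
  have W: "W (L2_class M' g) = L2_class M (\<lambda>x. h x * g x)" if g: "g \<in> square_integrable M'" for g
    unfolding W_def
  proof (rule UN_L2_class[OF g])
    fix k assume k: "k \<in> square_integrable M'" and "AE x in M'. g x = k x"
    then have "AE x in M. h x * g x = h x * k x" by (simp only: cong)
    then show "L2_class M (\<lambda>x. h x * k x) = L2_class M (\<lambda>x. h x * g x)"
      using L2_class_eq_iff[OF mult[OF g] mult[OF k]] by simp
  qed
  have "unitary_between (L2 M') (L2 M) W"
    unfolding unitary_between_def vectors_L2
  proof (intro conjI ballI allI)
    show "bij_betw W (L2_class M' ` square_integrable M') (L2_class M ` square_integrable M)"
    proof (rule bij_betw_imageI)
      show "inj_on W (L2_class M' ` square_integrable M')"
      proof (rule inj_onI)
        fix F G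
        assume "F \<in> L2_class M' ` square_integrable M'" "G \<in> L2_class M' ` square_integrable M'"
          and eq: "W F = W G"
        then obtain g k where g: "g \<in> square_integrable M'" "F = L2_class M' g"
          and k: "k \<in> square_integrable M'" "G = L2_class M' k" by auto
        from eq have "AE x in M. h x * g x = h x * k x"
          unfolding g(2) k(2) W[OF g(1)] W[OF k(1)] L2_class_eq_iff[OF mult[OF g(1)] mult[OF k(1)]] .
        then show "F = G"
          unfolding g(2) k(2) L2_class_eq_iff[OF g(1) k(1)] cong .
      qed
      show "W ` L2_class M' ` square_integrable M' = L2_class M ` square_integrable M"
      proof
        show "W ` L2_class M' ` square_integrable M' \<subseteq> L2_class M ` square_integrable M"
          by (auto simp: W mult)
        show "L2_class M ` square_integrable M \<subseteq> W ` L2_class M' ` square_integrable M'"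
        proof
          fix F assume "F \<in> L2_class M ` square_integrable M"
          then obtain k where k: "k \<in> square_integrable M" and F: "F = L2_class M k" by auto
          note [measurable] = square_integrable_measurable[OF k]
          \<comment> \<open>Where \<open>h\<close> vanishes the quotient is 0 by convention, so the
            product is bounded by \<open>k\<close> everywhere.\<close>
          have "(\<lambda>x. h x * (k x / h x)) \<in> square_integrable M"
            by (rule square_integrable_bound[OF k]) auto
          then have g: "(\<lambda>x. k x / h x) \<in> square_integrable M'"
            by (subst (asm) mult_sqrt_density_square_integrable[OF h dens]) measurable
          have "AE x in M. h x * (k x / h x) = k x"
            using nonzero by eventually_elim simp
          then have "W (L2_class M' (\<lambda>x. k x / h x)) = F"
            unfolding W[OF g] F L2_class_eq_iff[OF mult[OF g] k] .
          then show "F \<in> W ` L2_class M' ` square_integrable M'" using g by blast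
        qed
      qed
    qed
    show "W (vscale (L2 M') c F) = vscale (L2 M) c (W F)"
      if "F \<in> L2_class M' ` square_integrable M'" for F c
      using that by (auto simp: W vscale_L2 mult square_integrable_cmult mult.left_commute)
    fix F G
    assume "F \<in> L2_class M' ` square_integrable M'" "G \<in> L2_class M' ` square_integrable M'"
    then obtain g k where g: "g \<in> square_integrable M'" "F = L2_class M' g"
      and k: "k \<in> square_integrable M'" "G = L2_class M' k" by auto
    show "W (vadd (L2 M') F G) = vadd (L2 M) (W F) (W G)"
      using g k by (simp add: W vadd_L2 mult square_integrable_add distrib_left)
    note [measurable] = meas[OF g(1)] meas[OF k(1)]
    have "(\<integral>x. g x * cnj (k x) \<partial>M') = (\<integral>x. (cmod (h x))\<^sup>2 *\<^sub>R (g x * cnj (k x)) \<partial>M)"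
      unfolding dens[symmetric] by (rule integral_density) auto
    also have "\<dots> = (\<integral>x. h x * g x * cnj (h x * k x) \<partial>M)"
      by (intro Bochner_Integration.integral_cong refl)
        (simp only: scaleR_conv_of_real complex_norm_square complex_cnj_mult mult_ac)
    finally show "vinner (L2 M) (W F) (W G) = vinner (L2 M') F G"
      using g k by (simp add: W vinner_L2 mult)
  qed
  then show ?thesis using W mult by blast
qed

text \<open>Passes from the operator on classes to its graph on representatives, to which the locale
  \<open>intertwining\<close> applies.\<close>

lemma intertwining_unitary:
  assumes "monic N \<mu> f" "monic N \<mu>' f'"
    and W: "unitary_between (L2 \<mu>) (L2 \<mu>') W"
    and intertwines: "\<And>i F. i < N \<Longrightarrow> F \<in> vectors (L2 \<mu>) \<Longrightarrow>
      monic_rep \<mu>' f' i (W F) = W (monic_rep \<mu> f i F)"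
  shows "intertwining N \<mu> f \<mu>' f' (\<lambda>g k. g \<in> square_integrable \<mu> \<and> k \<in> square_integrable \<mu>' \<and>
    W (L2_class \<mu> g) = L2_class \<mu>' k)"
    (is "intertwining _ _ _ _ _ ?R")
proof -
  interpret dom: monic N \<mu> f by fact
  interpret cod: monic N \<mu>' f' by fact
  have bij: "bij_betw W (L2_class \<mu> ` square_integrable \<mu>) (L2_class \<mu>' ` square_integrable \<mu>')"
    and add: "\<And>F G. F \<in> vectors (L2 \<mu>) \<Longrightarrow> G \<in> vectors (L2 \<mu>) \<Longrightarrow>
      W (vadd (L2 \<mu>) F G) = vadd (L2 \<mu>') (W F) (W G)"
    and scale: "\<And>c F. F \<in> vectors (L2 \<mu>) \<Longrightarrow> W (vscale (L2 \<mu>) c F) = vscale (L2 \<mu>') c (W F)"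
    and inner: "\<And>F G. F \<in> vectors (L2 \<mu>) \<Longrightarrow> G \<in> vectors (L2 \<mu>) \<Longrightarrow>
      vinner (L2 \<mu>') (W F) (W G) = vinner (L2 \<mu>) F G"
    using W by (auto simp: unitary_between_def vectors_L2)
  have vectors: "L2_class \<mu> g \<in> vectors (L2 \<mu>)" if "g \<in> square_integrable \<mu>" for g
    using that by (simp add: vectors_L2)
  show ?thesis
  proof
    show "\<exists>k. ?R g k" if "g \<in> square_integrable \<mu>" for g
      using bij_betw_apply[OF bij, of "L2_class \<mu> g"] that by auto
    show "\<exists>g. ?R g k" if "k \<in> square_integrable \<mu>'" for k
    proof -
      have "L2_class \<mu>' k \<in> W ` L2_class \<mu> ` square_integrable \<mu>"
        using that bij by (simp add: bij_betw_def)
      then show ?thesis using that by force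
    qed
    show "?R (\<lambda>x. f i x * g (word_shift x)) (\<lambda>x. f' i x * k (word_shift x))"
      if R: "?R g k" and i: "i < N" for g k i
      using R i intertwines[OF i vectors[of g]] dom.monic_rep_L2_class[OF i, of g]
        cod.monic_rep_L2_class[OF i, of k] dom.rep_square_integrable[OF i, of g]
        cod.rep_square_integrable[OF i, of k]
      by simp
    show "?R g1 k" if "?R g k" "g1 \<in> square_integrable \<mu>" "AE x in \<mu>. g x = g1 x" for g k g1
      using that L2_class_eq_iff[of g \<mu> g1] by simp
    show "?R g k1" if "?R g k" "k1 \<in> square_integrable \<mu>'" "AE x in \<mu>'. k x = k1 x" for g k k1
      using that L2_class_eq_iff[of k \<mu>' k1] by simp
    fix g k g1 k1 assume R: "?R g k" and R1: "?R g1 k1"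
    show "(\<integral>x. g x * cnj (g1 x) \<partial>\<mu>) = (\<integral>x. k x * cnj (k1 x) \<partial>\<mu>')"
      using R R1 inner[OF vectors[of g] vectors[of g1]] by (simp add: vinner_L2)
    \<comment> \<open>Subtraction is not an operation of \<open>inner_space\<close>; it is obtained
      from \<open>vadd\<close> and from \<open>vscale\<close> by -1.\<close>
    have m: "(\<lambda>x. (-1) * g1 x) \<in> square_integrable \<mu>" "(\<lambda>x. (-1) * k1 x) \<in> square_integrable \<mu>'"
      using R1 square_integrable_cmult by blast+
    have "W (L2_class \<mu> (\<lambda>x. (-1) * g1 x)) = L2_class \<mu>' (\<lambda>x. (-1) * k1 x)"
      using R1 scale[OF vectors[of g1], of "-1"]
        vscale_L2[of g1 \<mu> "-1"] vscale_L2[of k1 \<mu>' "-1"] by simp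
    then have "W (L2_class \<mu> (\<lambda>x. g x + (-1) * g1 x)) = L2_class \<mu>' (\<lambda>x. k x + (-1) * k1 x)"
      using R add[OF vectors[of g] vectors[OF m(1)]] vadd_L2[OF _ m(1), of g]
        vadd_L2[OF _ m(2), of k] by simp
    then show "?R (\<lambda>x. g x - g1 x) (\<lambda>x. k x - k1 x)"
      using R R1 by (simp add: square_integrable_diff)
  qed auto
qed


section \<open>Equivalence of monic representations\<close>

theorem theorem2p9:
  fixes N :: nat
    and \<mu> \<mu>' :: "(nat \<Rightarrow> nat) measure"
    and f f' :: "nat \<Rightarrow> (nat \<Rightarrow> nat) \<Rightarrow> complex"
  assumes "N \<ge> 2"
    and "monic_system N \<mu> f"
    and "monic_system N \<mu>' f'"
  shows "equivalent_reps N (L2 \<mu>) (monic_rep \<mu> f) (L2 \<mu>') (monic_rep \<mu>' f') \<longleftrightarrow>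
    absolutely_continuous \<mu>' \<mu> \<and> absolutely_continuous \<mu> \<mu>' \<and>
    (\<exists>h \<in> borel_measurable \<mu>.
       (AE x in \<mu>. RN_deriv \<mu> \<mu>' x = ennreal ((cmod (h x))\<^sup>2)) \<and>
       (\<forall>i<N. AE x in \<mu>. f' i x = h (word_shift x) / h x * f i x))"
    (is "?equiv \<longleftrightarrow> ?rn")
proof -
  interpret M: monic N \<mu> f using assms(2) by (rule monic.intro)
  interpret M': monic N \<mu>' f' using assms(3) by (rule monic.intro)
  show ?thesis
  proof
    assume ?equiv
    then obtain W where unitary: "unitary_between (L2 \<mu>') (L2 \<mu>) W"
      and intertwines: "\<And>i F. i < N \<Longrightarrow> F \<in> vectors (L2 \<mu>') \<Longrightarrow>
        monic_rep \<mu> f i (W F) = W (monic_rep \<mu>' f' i F)"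
      by (auto simp: equivalent_reps_def)
    define R where "R = (\<lambda>g k. g \<in> square_integrable \<mu>' \<and> k \<in> square_integrable \<mu> \<and>
      W (L2_class \<mu>' g) = L2_class \<mu> k)"
    \<comment> \<open>The unitary runs from the primed space to the unprimed one, so the primed
      system is the domain; \<open>density_image_one\<close> now gives the density of
      \<open>\<mu>'\<close> with respect to \<open>\<mu>\<close>.\<close>
    interpret intertwining N \<mu>' f' \<mu> f R
      unfolding R_def using M'.monic_axioms M.monic_axioms unitary intertwines by (rule intertwining_unitary)
    interpret conv: intertwining N \<mu> f \<mu>' f' "\<lambda>k g. R g k" by (rule converse)
    obtain h where h: "R (\<lambda>x. 1) h" using ex_image_one by blast
    have h_meas [measurable]: "h \<in> borel_measurable \<mu>"
      by (rule square_integrable_measurable[OF cod_square_integrable[OF h]])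
    have "AE x in \<mu>. ennreal ((cmod (h x))\<^sup>2) = RN_deriv \<mu> \<mu>' x"
      by (rule M.RN_deriv_unique[OF _ density_image_one[OF h]]) measurable
    then have "AE x in \<mu>. RN_deriv \<mu> \<mu>' x = ennreal ((cmod (h x))\<^sup>2)"
      by eventually_elim simp
    moreover have "AE x in \<mu>. f' i x = h (word_shift x) / h x * f i x" if i: "i < N" for i
    proof -
      \<comment> \<open>The left function is S_i' 1. Its image is S_i \<open>h\<close> by
        intertwining, and \<open>h\<close> times \<open>f' i\<close> by
        \<open>image_eq_mult\<close>.\<close>
      have "R (\<lambda>x. f' i x * 1) (\<lambda>x. f i x * h (word_shift x))"
        by (rule rep[OF h i])
      then have "AE x in \<mu>. f i x * h (word_shift x) = h x * (f' i x * 1)"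
        by (rule image_eq_mult[OF h])
      with image_one_nonzero[OF h] show ?thesis
        by eventually_elim (simp add: field_simps)
    qed
    ultimately show ?rn
      using absolutely_continuous conv.absolutely_continuous h_meas by blast
  next
    assume ?rn
    then obtain h where ac: "absolutely_continuous \<mu>' \<mu>" "absolutely_continuous \<mu> \<mu>'"
      and h [measurable]: "h \<in> borel_measurable \<mu>"
      and RN: "AE x in \<mu>. RN_deriv \<mu> \<mu>' x = ennreal ((cmod (h x))\<^sup>2)"
      and f': "\<And>i. i < N \<Longrightarrow> AE x in \<mu>. f' i x = h (word_shift x) / h x * f i x"
      by blast
    have "density \<mu> (RN_deriv \<mu> \<mu>') = \<mu>'"
      using ac(2) by (rule M.density_RN_deriv) (simp add: M.sets_eq M'.sets_eq)
    moreover have "density \<mu> (RN_deriv \<mu> \<mu>') = density \<mu> (\<lambda>x. ennreal ((cmod (h x))\<^sup>2))"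
      by (rule density_cong[OF _ _ RN]) measurable
    ultimately have dens: "density \<mu> (\<lambda>x. ennreal ((cmod (h x))\<^sup>2)) = \<mu>'" by simp
    have nonzero: "AE x in \<mu>. h x \<noteq> 0" by (rule sqrt_density_nonzero[OF h dens ac(1)])
    obtain W where unitary: "unitary_between (L2 \<mu>') (L2 \<mu>) W"
      and W: "\<And>g. g \<in> square_integrable \<mu>' \<Longrightarrow> (\<lambda>x. h x * g x) \<in> square_integrable \<mu>"
        "\<And>g. g \<in> square_integrable \<mu>' \<Longrightarrow> W (L2_class \<mu>' g) = L2_class \<mu> (\<lambda>x. h x * g x)"
      using unitary_mult_sqrt_density[OF h dens nonzero] by blast
    have "monic_rep \<mu> f i (W F) = W (monic_rep \<mu>' f' i F)"
      if i: "i < N" and F: "F \<in> vectors (L2 \<mu>')" for i F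
    proof -
      from F obtain g where g: "g \<in> square_integrable \<mu>'" and F: "F = L2_class \<mu>' g"
        by (auto simp: vectors_L2)
      \<comment> \<open>Intertwining on representatives is the hypothesis on \<open>f' i\<close>
        multiplied by \<open>h\<close>, which is nonzero almost everywhere.\<close>
      have "AE x in \<mu>. f i x * (h (word_shift x) * g (word_shift x)) =
          h x * (f' i x * g (word_shift x))"
        using f'[OF i] nonzero by eventually_elim simp
      then have "L2_class \<mu> (\<lambda>x. f i x * (h (word_shift x) * g (word_shift x))) =
          L2_class \<mu> (\<lambda>x. h x * (f' i x * g (word_shift x)))"
        using M.rep_square_integrable[OF i W(1)[OF g]] W(1)[OF M'.rep_square_integrable[OF i g]]
        by (simp add: L2_class_eq_iff)
      then show ?thesis
        unfolding F W(2)[OF g] M.monic_rep_L2_class[OF i W(1)[OF g]]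
          M'.monic_rep_L2_class[OF i g] W(2)[OF M'.rep_square_integrable[OF i g]] .
    qed
    with unitary show ?equiv
      unfolding equivalent_reps_def by blast
  qed
qed

end
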